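(* Let $(Q,\cdot,/,\backslash)$ be a right division left cancelation groupoid which satisfies the cyclic associative law $x\cdot(y\cdot z)=(z\cdot x)\cdot y$ for all $x,y,z\in Q$. Then $(Q,\cdot)$ is a commutative group, and it satisfies each of the following identities for all $x,y,z\in Q$: $x\cdot(y\cdot z)=(x\cdot y)\cdot z$; $x\cdot(y\cdot z)=z\cdot(y\cdot x)$; $x\cdot(y\cdot z)=y\cdot(x\cdot z)$; $x\cdot(y\cdot z)=(z\cdot x)\cdot y$.
   Context: A groupoid $(Q,\cdot)$ is a non-empty set $Q$ with a binary operation $\cdot$. For $a\in Q$ let $L_a,R_a:Q\to Q$, $L_a x=a\cdot x$, $R_a x=x\cdot a$. The groupoid is a right division groupoid if $R_a$ is surjective for every $a\in Q$, and a left cancelation groupoid if $L_a$ is injective for every $a\in Q$. Writing a right division left cancelation groupoid as $(Q,\cdot,/,\backslash)$ means that $/$ and $\backslash$ are binary operations on $Q$ satisfying $(y/x)\cdot x=y$ and $x\backslash(x\cdot y)=y$ for all $x,y\in Q$. *)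

theory Defs
  imports Main "HOL-Algebra.Group"
begin

locale groupoid =
  fixes Q :: "'a set" and mul :: "'a \<Rightarrow> 'a \<Rightarrow> 'a" (infixl "\<cdot>" 70)
  assumes nonempty: "Q \<noteq> {}"
    and mul_closed: "\<lbrakk>x \<in> Q; y \<in> Q\<rbrakk> \<Longrightarrow> x \<cdot> y \<in> Q"

locale right_division_groupoid = groupoid +
  assumes surj_right_translation: "a \<in> Q \<Longrightarrow> (\<lambda>x. x \<cdot> a) ` Q = Q"

locale left_cancelation_groupoid = groupoid +
  assumes inj_left_translation: "a \<in> Q \<Longrightarrow> inj_on (\<lambda>x. a \<cdot> x) Q"

text \<open>
  Here \<open>rdiv y x\<close> stands for $y / x$ and \<open>ldiv x y\<close> for $x \backslash y$. Given operations
  \<open>rdiv\<close> and \<open>ldiv\<close> on \<open>Q\<close>, the two identities already imply the surjectivity and injectivity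
  conditions.
\<close>
locale right_division_left_cancelation_groupoid =
  right_division_groupoid Q mul + left_cancelation_groupoid Q mul
  for Q :: "'a set" and mul :: "'a \<Rightarrow> 'a \<Rightarrow> 'a" (infixl "\<cdot>" 70) +
  fixes rdiv :: "'a \<Rightarrow> 'a \<Rightarrow> 'a" and ldiv :: "'a \<Rightarrow> 'a \<Rightarrow> 'a"
  assumes rdiv_closed: "\<lbrakk>x \<in> Q; y \<in> Q\<rbrakk> \<Longrightarrow> rdiv y x \<in> Q"
    and ldiv_closed: "\<lbrakk>x \<in> Q; y \<in> Q\<rbrakk> \<Longrightarrow> ldiv x y \<in> Q"
    and rdiv_mul: "\<lbrakk>x \<in> Q; y \<in> Q\<rbrakk> \<Longrightarrow> rdiv y x \<cdot> x = y"
    and ldiv_mul: "\<lbrakk>x \<in> Q; y \<in> Q\<rbrakk> \<Longrightarrow> ldiv x (x \<cdot> y) = y"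

text \<open>The unit is not part of the structure \<open>(Q, mul)\<close>, hence the existential quantifier.\<close>
definition is_comm_group :: "'a set \<Rightarrow> ('a \<Rightarrow> 'a \<Rightarrow> 'a) \<Rightarrow> bool" where
  "is_comm_group Q mul \<longleftrightarrow> (\<exists>e. comm_group \<lparr>carrier = Q, monoid.mult = mul, one = e\<rparr>)"

end

(*
  Choose e with e a = a. The cyclic law gives a (y e) = (e a) y = a y, so by left cancelation e is a
  right unit. Then (e x) y = x (y e) = x y, and y = e shows that e is also a left unit. Finally
  y z = e (y z) = (z e) y = z y, so the operation is commutative and the cyclic law is associativity.
*)
theory Submission
  imports Defs
begin

text \<open>A left unit and left inverses suffice, since commutativity supplies the right-hand
  versions. The given \<open>e\<close> is the witness for the existential in
  \<open>is_comm_group\<close>.\<close>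

lemma (in groupoid) is_comm_groupI:
  assumes "e \<in> Q"
    and "\<And>x. x \<in> Q \<Longrightarrow> mul e x = x"
    and "\<And>x. x \<in> Q \<Longrightarrow> \<exists>y\<in>Q. mul y x = e"
    and "\<And>x y. \<lbrakk>x \<in> Q; y \<in> Q\<rbrakk> \<Longrightarrow> mul x y = mul y x"
    and "\<And>x y z. \<lbrakk>x \<in> Q; y \<in> Q; z \<in> Q\<rbrakk> \<Longrightarrow> mul (mul x y) z = mul x (mul y z)"
  shows "is_comm_group Q mul"
proof -
  have "comm_group \<lparr>carrier = Q, monoid.mult = mul, one = e\<rparr>"
    by (rule comm_groupI) (use assms mul_closed in auto)
  then show ?thesis
    unfolding is_comm_group_def by blast
qed

lemma (in right_division_left_cancelation_groupoid) left_cancel: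
  assumes "a \<in> Q" "x \<in> Q" "y \<in> Q" "a \<cdot> x = a \<cdot> y"
  shows "x = y"
  using assms ldiv_mul by metis

text \<open>Bundles the cyclic law with the division operations, so that unit, commutativity and
  associativity are derived in one context and reach the theorem by interpretation.\<close>

locale cyclic_associative_division_groupoid =
  right_division_left_cancelation_groupoid +
  assumes cyclic: "\<lbrakk>x \<in> Q; y \<in> Q; z \<in> Q\<rbrakk> \<Longrightarrow> x \<cdot> (y \<cdot> z) = (z \<cdot> x) \<cdot> y"
begin

lemma right_unit:
  obtains e where "e \<in> Q" "\<And>x. x \<in> Q \<Longrightarrow> x \<cdot> e = x"
proof -
  obtain a where a: "a \<in> Q"
    using nonempty by blast
  \<comment> \<open>Right division solves \<open>e \<cdot> a = a\<close>; at this point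
    \<open>e\<close> is known to act as a unit only on the left of this single
    \<open>a\<close>.\<close>
  define e where "e = rdiv a a"
  have e: "e \<in> Q" and ea: "e \<cdot> a = a"
    unfolding e_def using a rdiv_closed rdiv_mul by blast+
  have "x \<cdot> e = x" if x: "x \<in> Q" for x
  proof (rule left_cancel[OF a])
    \<comment> \<open>The cyclic law carries \<open>e\<close> from the right of \<open>x\<close> to
      the left of \<open>a\<close>, where it is absorbed.\<close>
    show "a \<cdot> (x \<cdot> e) = a \<cdot> x"
      using cyclic[OF a x e] ea by simp
  qed (use x e mul_closed in auto)
  with e show thesis
    by (rule that)
qed

lemma two_sided_unit:
  obtains e where "e \<in> Q" "\<And>x. x \<in> Q \<Longrightarrow> x \<cdot> e = x" "\<And>x. x \<in> Q \<Longrightarrow> e \<cdot> x = x"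
proof -
  obtain e where e: "e \<in> Q" and unit: "\<And>x. x \<in> Q \<Longrightarrow> x \<cdot> e = x"
    using right_unit by blast
  have "e \<cdot> x = x" if x: "x \<in> Q" for x
    \<comment> \<open>This instance reads
      \<open>x \<cdot> (e \<cdot> e) = (e \<cdot> x) \<cdot> e\<close>; the right unit law collapses
      it to \<open>x = e \<cdot> x\<close>.\<close>
    using cyclic[OF x e e] unit[OF e] unit[OF x] unit[OF mul_closed[OF e x]] by simp
  with e unit show thesis
    by (rule that)
qed

lemma commute:
  assumes x: "x \<in> Q" and y: "y \<in> Q"
  shows "x \<cdot> y = y \<cdot> x"
proof -
  obtain e where e: "e \<in> Q" "\<And>x. x \<in> Q \<Longrightarrow> x \<cdot> e = x" "\<And>x. x \<in> Q \<Longrightarrow> e \<cdot> x = x"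
    using two_sided_unit by blast
  show ?thesis
    using cyclic[OF e(1) x y] e(2)[OF y] e(3)[OF mul_closed[OF x y]] by simp
qed

text \<open>Two cyclic shifts with one commutation between them restore the order of the factors and
  move the brackets.\<close>

lemma assoc:
  assumes x: "x \<in> Q" and y: "y \<in> Q" and z: "z \<in> Q"
  shows "x \<cdot> (y \<cdot> z) = (x \<cdot> y) \<cdot> z"
proof -
  have "x \<cdot> (y \<cdot> z) = (z \<cdot> x) \<cdot> y"
    by (rule cyclic[OF x y z])
  also have "\<dots> = y \<cdot> (z \<cdot> x)"
    by (rule commute[OF mul_closed[OF z x] y])
  also have "\<dots> = (x \<cdot> y) \<cdot> z"
    by (rule cyclic[OF y z x])
  finally show ?thesis .
qed

end

theorem theorem3:
  fixes Q :: "'a set" and mul :: "'a \<Rightarrow> 'a \<Rightarrow> 'a" (infixl "\<cdot>" 70)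
    and rdiv ldiv :: "'a \<Rightarrow> 'a \<Rightarrow> 'a"
  assumes "right_division_left_cancelation_groupoid Q (\<cdot>) rdiv ldiv"
    and cyclic_assoc: "\<forall>x\<in>Q. \<forall>y\<in>Q. \<forall>z\<in>Q. x \<cdot> (y \<cdot> z) = (z \<cdot> x) \<cdot> y"
  shows "is_comm_group Q (\<cdot>)
    \<and> (\<forall>x\<in>Q. \<forall>y\<in>Q. \<forall>z\<in>Q. x \<cdot> (y \<cdot> z) = (x \<cdot> y) \<cdot> z)
    \<and> (\<forall>x\<in>Q. \<forall>y\<in>Q. \<forall>z\<in>Q. x \<cdot> (y \<cdot> z) = z \<cdot> (y \<cdot> x))
    \<and> (\<forall>x\<in>Q. \<forall>y\<in>Q. \<forall>z\<in>Q. x \<cdot> (y \<cdot> z) = y \<cdot> (x \<cdot> z))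
    \<and> (\<forall>x\<in>Q. \<forall>y\<in>Q. \<forall>z\<in>Q. x \<cdot> (y \<cdot> z) = (z \<cdot> x) \<cdot> y)"
proof -
  interpret right_division_left_cancelation_groupoid Q "(\<cdot>)" rdiv ldiv
    by fact
  interpret cyclic_associative_division_groupoid Q "(\<cdot>)" rdiv ldiv
    by unfold_locales (use cyclic_assoc in blast)
  obtain e where e: "e \<in> Q" "\<And>x. x \<in> Q \<Longrightarrow> x \<cdot> e = x" "\<And>x. x \<in> Q \<Longrightarrow> e \<cdot> x = x"
    using two_sided_unit by blast
  have group: "is_comm_group Q (\<cdot>)"
  proof (rule is_comm_groupI[OF e(1,3)])
    show "\<exists>y\<in>Q. y \<cdot> x = e" if "x \<in> Q" for x
      \<comment> \<open>The left inverse of \<open>x\<close> is \<open>rdiv e x\<close>.\<close>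
      using rdiv_mul[OF that e(1)] rdiv_closed[OF that e(1)] rdiv_closed[OF e(1) that] by blast
    show "x \<cdot> y = y \<cdot> x" if "x \<in> Q" "y \<in> Q" for x y
      by (rule commute[OF that])
    show "(x \<cdot> y) \<cdot> z = x \<cdot> (y \<cdot> z)" if "x \<in> Q" "y \<in> Q" "z \<in> Q" for x y z
      by (rule assoc[OF that, symmetric])
  qed
  have swap_outer: "x \<cdot> (y \<cdot> z) = z \<cdot> (y \<cdot> x)" if x: "x \<in> Q" and y: "y \<in> Q" and z: "z \<in> Q" for x y z
    using assoc[OF x y z] commute[OF mul_closed[OF x y] z] commute[OF x y] by simp
  have left_commute: "x \<cdot> (y \<cdot> z) = y \<cdot> (x \<cdot> z)" if x: "x \<in> Q" and y: "y \<in> Q" and z: "z \<in> Q" for x y z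
    \<comment> \<open>Bracketed to the left, the sides are \<open>(x \<cdot> y) \<cdot> z\<close>
      and \<open>(y \<cdot> x) \<cdot> z\<close>, which commutativity identifies.\<close>
    by (simp only: assoc[OF x y z] assoc[OF y x z] commute[OF x y])
  show ?thesis
    by (intro conjI ballI group) (fact assoc swap_outer left_commute cyclic)+
qed

end
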